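(* There is no 3-net in $\mathbb{P}^2$ realizing the group $\mathbb{Z}_2^2$ in which at least one class is a pencil.
   Context: A 3-net in $\mathbb{P}^2$ is a pair $(\mathcal{A},\mathcal{X})$ where $\mathcal{A}$ is a finite set of lines in the complex projective plane partitioned into 3 classes $\mathcal{A}=\mathcal{A}_1\cup\mathcal{A}_2\cup\mathcal{A}_3$ and $\mathcal{X}$ is a finite set of points such that: (i) for every $i\neq j$ and every $l\in\mathcal{A}_i$, $l'\in\mathcal{A}_j$, $l\cap l'\in\mathcal{X}$; (ii) for every $X\in\mathcal{X}$ and every $i$ there is a unique $l\in\mathcal{A}_i$ through $X$. A class is a pencil if all its lines pass through a common point. A 3-net realizes a group $H$ if there are bijections $\phi_i:H\to\mathcal{A}_i$ ($i=1,2,3$) such that for all $a,b\in H$ the line $\phi_3(ab)$ passes through the point $\phi_1(a)\cap\phi_2(b)$. *)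

theory Defs
  imports
    "HOL-Analysis.Cartesian_Space"
    "HOL-Library.Disjoint_Sets"
    "HOL-Algebra.Elementary_Groups"
begin

type_synonym proj_point = "(complex ^ 3) set"

type_synonym proj_line = "proj_point set"

text \<open>The complex projective plane: points are the one-dimensional linear subspaces of
  \<open>\<complex>\<^sup>3\<close> (the prefix \<open>vec\<close> refers to the complex scalar multiplication \<open>*s\<close>); a line is the
  set of all points contained in a fixed two-dimensional subspace.\<close>

definition proj_points :: "proj_point set" where
  "proj_points = {p. vec.subspace p \<and> vec.dim p = 1}"

definition proj_lines :: "proj_line set" where
  "proj_lines = {{p \<in> proj_points. p \<subseteq> W} | W. vec.subspace W \<and> vec.dim W = 2}"

text \<open>The classes of the net are \<open>C 1\<close>, \<open>C 2\<close>, \<open>C 3\<close>. As a line is a set of points,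
  the requirement that the intersection point of two lines belongs to \<open>X\<close> reads
  \<open>l \<inter> l' = {P}\<close> for some \<open>P \<in> X\<close>.\<close>

definition three_net :: "proj_line set \<Rightarrow> (nat \<Rightarrow> proj_line set) \<Rightarrow> proj_point set \<Rightarrow> bool" where
  "three_net A C X \<longleftrightarrow>
     finite A \<and> A \<subseteq> proj_lines \<and>
     A = (\<Union>i\<in>{1..3}. C i) \<and> disjoint_family_on C {1..3} \<and> (\<forall>i\<in>{1..3}. C i \<noteq> {}) \<and>
     finite X \<and> X \<subseteq> proj_points \<and>
     (\<forall>i\<in>{1..3}. \<forall>j\<in>{1..3}. i \<noteq> j \<longrightarrow>
        (\<forall>l\<in>C i. \<forall>l'\<in>C j. \<exists>P\<in>X. l \<inter> l' = {P})) \<and>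
     (\<forall>P\<in>X. \<forall>i\<in>{1..3}. \<exists>!l. l \<in> C i \<and> P \<in> l)"

definition is_pencil :: "proj_line set \<Rightarrow> bool" where
  "is_pencil L \<longleftrightarrow> (\<exists>P\<in>proj_points. \<forall>l\<in>L. P \<in> l)"

definition realizes_group :: "(nat \<Rightarrow> proj_line set) \<Rightarrow> ('h, 'm) monoid_scheme \<Rightarrow> bool" where
  "realizes_group C H \<longleftrightarrow>
     (\<exists>\<phi> :: nat \<Rightarrow> 'h \<Rightarrow> proj_line.
        (\<forall>i\<in>{1..3}. bij_betw (\<phi> i) (carrier H) (C i)) \<and>
        (\<forall>a\<in>carrier H. \<forall>b\<in>carrier H.
           \<exists>P. \<phi> 1 a \<inter> \<phi> 2 b = {P} \<and> P \<in> \<phi> 3 (a \<otimes>\<^bsub>H\<^esub> b)))"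

end

theory Submission imports Defs begin

text \<open>Let the third class be the pencil, with centre spanned by \<open>q\<close>. No line of the other two
  classes passes through the centre, so these lines have equations \<open>F a = 0\<close> and \<open>G b = 0\<close> with
  linear forms normalised by \<open>F a q = G b q = 1\<close>. Then \<open>G b - F a\<close> vanishes at the centre and at
  the intersection point of the two lines, hence on the line of the pencil with label \<open>a + b\<close>.
  Evaluating this on the four lines of the pencil, whose planes are spanned by \<open>q\<close> and one further
  vector each, gives linear relations between the values of the \<open>F a\<close>. These relations force
  \<open>F a = F b\<close> for two distinct labels.\<close>

section \<open>Linear forms, points and planes in complex 3-space\<close>

abbreviation linear_form :: "(complex ^ 3 \<Rightarrow> complex) \<Rightarrow> bool" where
  "linear_form \<equiv> Vector_Spaces.linear (*s) (*)"

text \<open>The scalars count here as a vector space over themselves, so that the general facts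
  about linear maps apply to linear forms.\<close>

interpretation form: vector_space_pair "(*s) :: complex \<Rightarrow> complex ^ 3 \<Rightarrow> complex ^ 3"
    "(*) :: complex \<Rightarrow> complex \<Rightarrow> complex"
  by unfold_locales (auto simp: algebra_simps)

abbreviation (input) line_of :: "(complex ^ 3) set \<Rightarrow> proj_line" where
  "line_of W \<equiv> {p \<in> proj_points. p \<subseteq> W}"

lemma proj_point_span:
  assumes "P \<in> proj_points"
  obtains q where "q \<noteq> 0" "P = vec.span {q}"
proof -
  have P: "vec.subspace P" "vec.dim P = 1" using assms by (auto simp: proj_points_def)
  obtain B where B: "B \<subseteq> P" "vec.independent B" "P \<subseteq> vec.span B" "card B = vec.dim P"
    using vec.basis_exists by blast
  from B(4) P(2) obtain q where q: "B = {q}" by (auto simp: card_1_singleton_iff)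
  have "q \<noteq> 0" using B(2) q by auto
  moreover have "P = vec.span {q}"
    using B(1,3) P(1) vec.span_minimal[of B P] q by auto
  ultimately show thesis using that by blast
qed

lemma proj_lines_planes:
  assumes "u ` H \<subseteq> proj_lines"
  obtains U where "\<And>a. a \<in> H \<Longrightarrow>
    vec.subspace (U a) \<and> vec.dim (U a) = 2 \<and> u a = line_of (U a)"
proof -
  have "\<forall>a\<in>H. \<exists>S. vec.subspace S \<and> vec.dim S = 2 \<and> u a = line_of S"
  proof
    fix a assume "a \<in> H"
    then have "u a \<in> proj_lines" using assms by auto
    then show "\<exists>S. vec.subspace S \<and> vec.dim S = 2 \<and> u a = line_of S"
      unfolding proj_lines_def by auto
  qed
  from bchoice[OF this] show thesis using that by auto
qed

text \<open>Translates incidence of a projective point with a line into membership of a spanning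
  vector in the plane of that line.\<close>

lemma span_singleton_subset_iff:
  assumes "vec.subspace W"
  shows "vec.span {q} \<subseteq> W \<longleftrightarrow> q \<in> W"
  using assms vec.span_minimal[of "{q}" W] vec.span_base[of q "{q}"] by auto

lemma plane_ex_outside_point:
  fixes W :: "(complex ^ 3) set"
  assumes "vec.dim W = 2"
  shows "\<exists>x\<in>W. x \<notin> vec.span {q}"
proof -
  have "vec.dim (vec.span {q}) \<le> 1"
    using vec.dim_le_card[of "vec.span {q}" "{q}"] by auto
  then show ?thesis using vec.dim_subset[of W "vec.span {q}"] assms by fastforce
qed

lemma plane_eq_span:
  fixes W :: "(complex ^ 3) set"
  assumes W: "vec.subspace W" "vec.dim W = 2" and "q \<noteq> 0" "q \<in> W" "x \<in> W" "x \<notin> vec.span {q}"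
  shows "W = vec.span {q, x}"
proof -
  have ne: "x \<noteq> q" using assms(6) vec.span_base[of q "{q}"] by auto
  have "vec.independent {x, q}"
    using assms by (subst vec.independent_insert) auto
  then have "W \<subseteq> vec.span {x, q}"
    using vec.card_ge_dim_independent[of "{x, q}" W] assms ne by auto
  moreover have "vec.span {x, q} \<subseteq> W" by (rule vec.span_minimal) (use assms in auto)
  ultimately show ?thesis by (auto simp: insert_commute)
qed

lemma plane_extend_span:
  fixes W :: "(complex ^ 3) set"
  assumes W: "vec.subspace W" "vec.dim W = 2" and "q \<noteq> 0" "q \<in> W" "x \<in> W" "x \<notin> vec.span {q}"
    and y: "y \<notin> W"
  shows "vec.span {q, x, y} = UNIV"
proof -
  have W_eq: "W = vec.span {q, x}" by (rule plane_eq_span) (use assms in auto)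
  have ne: "x \<noteq> q" "y \<noteq> q" "y \<noteq> x"
    using assms vec.span_base[of q "{q}"] by auto
  have "vec.independent {x, q}"
    using assms by (subst vec.independent_insert) auto
  then have "vec.independent {y, q, x}"
    using y W_eq by (subst vec.independent_insert) (auto simp: insert_commute)
  then have "UNIV \<subseteq> vec.span {y, q, x}"
    using vec.card_ge_dim_independent[of "{y, q, x}" UNIV] ne
    by (auto simp: vec_dim_card simp del: vec.dim_UNIV)
  then show ?thesis by (auto simp: insert_commute)
qed

text \<open>A basis of \<open>W\<close> together with \<open>q\<close> is a basis of the whole
  space, and \<open>f\<close> is its coordinate along \<open>q\<close>. Every \<open>x\<close>
  differs from some multiple \<open>k *s q\<close> by a vector of \<open>W\<close>, so
  \<open>k = f x\<close>, and the kernel is exactly \<open>W\<close>. With this normalisation any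
  two such forms agree at \<open>q\<close>.\<close>

lemma plane_has_form:
  fixes W :: "(complex ^ 3) set"
  assumes W: "vec.subspace W" "vec.dim W = 2" and q: "q \<notin> W"
  shows "\<exists>f. linear_form f \<and> f q = 1 \<and> (\<forall>x. f x = 0 \<longleftrightarrow> x \<in> W)"
proof -
  obtain B where B: "B \<subseteq> W" "vec.independent B" "W \<subseteq> vec.span B" "card B = vec.dim W"
    using vec.basis_exists by blast
  have fin: "finite B" using B(2) vec.finiteI_independent by blast
  have W_eq: "W = vec.span B" using B W vec.span_minimal[of B W] by auto
  have qB: "q \<notin> B" using q B by auto
  have ind: "vec.independent (insert q B)"
    using q W_eq B qB by (subst vec.independent_insert) auto
  obtain f where f: "linear_form f" "\<And>x. x \<in> insert q B \<Longrightarrow> f x = (if x = q then 1 else 0)"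
    using form.linear_independent_extend[OF ind, of "\<lambda>x. if x = q then 1 else 0"] by blast
  have fB: "f x = 0" if "x \<in> W" for x
    using form.linear_eq_0_on_span[OF f(1), of B x] f(2) qB that W_eq by fastforce
  have "UNIV \<subseteq> vec.span (insert q B)"
    by (rule vec.card_ge_dim_independent) (use ind fin qB B W in \<open>auto simp: vec_dim_card simp del: vec.dim_UNIV\<close>)
  then have "\<exists>k. x - k *s q \<in> W" for x
    unfolding W_eq using vec.span_breakdown_eq[of x q B] by auto
  moreover have "f (x - k *s q) = f x - k" for x k
    using f by (simp add: form.linear_diff form.linear_scale)
  ultimately have "x \<in> W" if "f x = 0" for x
    using that fB
    by (metis diff_0 neg_equal_0_iff_equal diff_zero vec.scale_zero_left)
  with f fB show ?thesis by (intro exI[of _ f]) auto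
qed

lemma forms_eq_on_plane:
  fixes W :: "(complex ^ 3) set"
  assumes "linear_form f" "linear_form g" "f q = g q" "f x = g x"
    "vec.subspace W" "vec.dim W = 2" "q \<noteq> 0" "q \<in> W" "x \<in> W" "x \<notin> vec.span {q}" "y \<in> W"
  shows "f y = g y"
  by (rule form.linear_eq_on_span[of f g "{q, x}"]) (use assms plane_eq_span[of W q x] in auto)

section \<open>Coordinates on a pencil of planes\<close>

text \<open>Since \<open>V0\<close> and \<open>V1\<close> are distinct planes through
  \<open>q\<close>, the vectors \<open>q\<close>, \<open>x0\<close>, \<open>x1\<close> form a basis.
  Expand in it a vector of \<open>V\<close> outside the span of \<open>q\<close>: if the coefficient
  of \<open>x0\<close> or of \<open>x1\<close> vanished, that vector and \<open>q\<close> would span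
  \<open>V1\<close> or \<open>V0\<close>, making \<open>V\<close> equal to it.\<close>

lemma plane_coordinates:
  fixes V0 V1 V :: "(complex ^ 3) set"
  assumes V: "vec.subspace V0" "vec.dim V0 = 2" "vec.subspace V1" "vec.dim V1 = 2"
      "vec.subspace V" "vec.dim V = 2"
    and ne: "V0 \<noteq> V1" "V \<noteq> V0" "V \<noteq> V1"
    and q: "q \<noteq> 0" "q \<in> V0" "q \<in> V1" "q \<in> V"
    and x: "x0 \<in> V0" "x0 \<notin> vec.span {q}" "x1 \<in> V1" "x1 \<notin> vec.span {q}"
  obtains k m n where "k \<noteq> 0" "m \<noteq> 0" "k *s x0 + m *s x1 + n *s q \<in> V"
proof -
  have V0: "V0 = vec.span {q, x0}" and V1: "V1 = vec.span {q, x1}"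
    by (rule plane_eq_span; use assms in auto)+
  obtain y where y: "y \<in> V" "y \<notin> vec.span {q}" using plane_ex_outside_point[OF V(6)] by blast
  have Vy: "V = vec.span {q, y}" by (rule plane_eq_span) (use assms y in auto)
  have "x1 \<notin> V0"
    using plane_eq_span[of V0 q x1] V1 assms by auto
  then have "y \<in> vec.span {x1, x0, q}"
    using plane_extend_span[of V0 q x0 x1] assms by (auto simp: insert_commute)
  then obtain m k n where "y - m *s x1 - k *s x0 - n *s q = 0"
    by (auto simp: vec.span_breakdown_eq)
  then have y_eq: "y = k *s x0 + m *s x1 + n *s q" by (simp add: algebra_simps)
  have "k \<noteq> 0"
  proof
    assume "k = 0"
    then have "y \<in> V1" using y_eq V q x by (auto intro!: vec.subspace_add vec.subspace_scale)
    then show False using plane_eq_span[of V1 q y] assms y Vy by auto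
  qed
  moreover have "m \<noteq> 0"
  proof
    assume "m = 0"
    then have "y \<in> V0" using y_eq V q x by (auto intro!: vec.subspace_add vec.subspace_scale)
    then show False using plane_eq_span[of V0 q y] assms y Vy by auto
  qed
  ultimately show thesis using that y y_eq by auto
qed

section \<open>Relations between the forms over a Klein four-group\<close>

text \<open>Here \<open>xa\<close> and \<open>ya\<close> stand for the values at two fixed vectors
  of the form with label \<open>a\<close>, where \<open>e\<close> is the identity and
  \<open>r = s + t\<close>. Adding the first two equations cancels the terms with \<open>k\<close>;
  adding the last two cancels those with \<open>m\<close>.\<close>

lemma direction_relations:
  fixes k m n :: complex
  assumes "k \<noteq> 0" "m \<noteq> 0"
    and "k * xe + m * ys + n = k * xt + m * yt + n"
    and "k * xt + m * yr + n = k * xe + m * ye + n"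
    and "k * xs + m * ye + n = k * xr + m * yr + n"
  shows "ys + yr = yt + ye" "xt + xs = xe + xr"
proof -
  have "m * (ys + yr) = m * (yt + ye)" using assms(3,4) by (simp add: algebra_simps) algebra
  then show "ys + yr = yt + ye" using assms(2) by simp
  have "k * (xt + xs) = k * (xe + xr)" using assms(4,5) by (simp add: algebra_simps) algebra
  then show "xt + xs = xe + xr" using assms(1) by simp
qed

text \<open>The argument takes place in the Klein four-group of \<open>\<one>\<close>,
  \<open>s\<close>, \<open>t\<close> and \<open>r\<close>. Vectors \<open>x\<close> on
  \<open>W \<one>\<close> and \<open>y\<close> on \<open>W s\<close> complete \<open>q\<close> to a
  basis. All values of the \<open>G b\<close> are rewritten as values of the \<open>F a\<close>, and
  the planes \<open>W t\<close> and \<open>W r\<close> then supply enough relations to give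
  \<open>F \<one>\<close> and \<open>F s\<close> the same values at \<open>x\<close> and
  \<open>y\<close>.\<close>

lemma elementary_abelian_forms_coincide:
  fixes H :: "('h, 'm) monoid_scheme" (structure)
    and F G :: "'h \<Rightarrow> complex ^ 3 \<Rightarrow> complex" and W :: "'h \<Rightarrow> (complex ^ 3) set"
  assumes "comm_group H" and sq: "\<And>a. a \<in> carrier H \<Longrightarrow> a \<otimes> a = \<one>"
    and st: "s \<in> carrier H" "t \<in> carrier H" "s \<noteq> \<one>" "t \<noteq> \<one>" "s \<noteq> t"
    and W: "\<And>c. c \<in> carrier H \<Longrightarrow> vec.subspace (W c) \<and> vec.dim (W c) = 2 \<and> q \<in> W c"
    and q: "q \<noteq> 0" and inj: "inj_on W (carrier H)"
    and F: "\<And>a. a \<in> carrier H \<Longrightarrow> linear_form (F a) \<and> F a q = 1"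
    and G: "\<And>a. a \<in> carrier H \<Longrightarrow> linear_form (G a) \<and> G a q = 1"
    and FG: "\<And>a b x. \<lbrakk>a \<in> carrier H; b \<in> carrier H; x \<in> W (a \<otimes> b)\<rbrakk> \<Longrightarrow> F a x = G b x"
  shows "F \<one> = F s"
proof -
  interpret comm_group H by fact
  define r where "r = s \<otimes> t"
  have r: "r \<in> carrier H" using st by (simp add: r_def)
  have cancel: "a \<otimes> (a \<otimes> b) = b" if "a \<in> carrier H" "b \<in> carrier H" for a b
    using that sq by (simp flip: m_assoc)
  have tab: "s \<otimes> t = r" "t \<otimes> s = r" "s \<otimes> r = t" "r \<otimes> s = t" "t \<otimes> r = s" "r \<otimes> t = s"
    "s \<otimes> s = \<one>" "t \<otimes> t = \<one>" "r \<otimes> r = \<one>"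
    using st r sq cancel[of s t] cancel[of t s] m_comm[of t s] m_comm[of r s] m_comm[of r t]
    by (auto simp: r_def)
  have rn: "r \<noteq> \<one>" "r \<noteq> s" "r \<noteq> t"
    using st tab(3,5,7,8) r_one[of s] by auto
  \<comment> \<open>In exponent two the only label paired with \<open>b\<close> over the plane
    \<open>W c\<close> is \<open>b \<otimes> c\<close>.\<close>
  have shift: "F (b \<otimes> c) x = G b x" if "b \<in> carrier H" "c \<in> carrier H" "x \<in> W c" for b c x
    using FG[of "b \<otimes> c" b x] that cancel[of b c] m_comm[of "b \<otimes> c" b] by simp
  have ex: "\<exists>x \<in> W c. x \<notin> vec.span {q}" if "c \<in> carrier H" for c
    using plane_ex_outside_point W[OF that] by blast
  obtain x where x: "x \<in> W \<one>" "x \<notin> vec.span {q}" using ex by blast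
  obtain y where y: "y \<in> W s" "y \<notin> vec.span {q}" using ex st by blast
  have Gx: "G b x = F b x" if "b \<in> carrier H" for b
    using shift[of b \<one> x] that x by simp
  have Gy: "G b y = F (b \<otimes> s) y" if "b \<in> carrier H" for b
    using shift[of b s y] that y st by simp
  \<comment> \<open>Evaluate \<open>F (b \<otimes> c) = G b\<close> at the vector
    \<open>k *s x + m *s y + n *s q\<close> of \<open>W c\<close>; the term \<open>n\<close> comes
    from the value 1 at \<open>q\<close>. The coefficients depend on \<open>c\<close> only, so the
    equations for different \<open>b\<close> can be added.\<close>
  have rel: "\<exists>k m n. k \<noteq> 0 \<and> m \<noteq> 0 \<and> (\<forall>b\<in>carrier H.
      k * F b x + m * F (b \<otimes> s) y + n = k * F (b \<otimes> c) x + m * F (b \<otimes> c) y + n)"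
    if c: "c \<in> carrier H" "c \<noteq> \<one>" "c \<noteq> s" for c
  proof -
    have ne: "W \<one> \<noteq> W s" "W c \<noteq> W \<one>" "W c \<noteq> W s"
      using inj c st by (auto dest: inj_onD)
    obtain k m n where kmn: "k \<noteq> 0" "m \<noteq> 0" "k *s x + m *s y + n *s q \<in> W c"
      by (rule plane_coordinates[of "W \<one>" "W s" "W c" q x y])
        (use W[of \<one>] W[of s] W[of c] ne x y q c st in auto)
    have "k * F b x + m * F (b \<otimes> s) y + n = k * F (b \<otimes> c) x + m * F (b \<otimes> c) y + n"
      if b: "b \<in> carrier H" for b
    proof -
      have "F (b \<otimes> c) (k *s x + m *s y + n *s q) = G b (k *s x + m *s y + n *s q)"
        using shift[OF b c(1) kmn(3)] .
      then show ?thesis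
        using F[of "b \<otimes> c"] G[of b] b c Gx[OF b] Gy[OF b]
        by (simp add: form.linear_add form.linear_scale)
    qed
    with kmn show ?thesis by blast
  qed
  from rel[of t] st obtain k m n where kmn: "k \<noteq> 0" "m \<noteq> 0" and
    t: "\<And>b. b \<in> carrier H \<Longrightarrow>
      k * F b x + m * F (b \<otimes> s) y + n = k * F (b \<otimes> t) x + m * F (b \<otimes> t) y + n"
    by metis
  have 1: "F s y + F r y = F t y + F \<one> y" "F t x + F s x = F \<one> x + F r x"
    by (rule direction_relations[OF kmn, of _ _ n];
        use t[of \<one>] t[of t] t[of s] st in \<open>simp add: tab\<close>)+
  \<comment> \<open>The plane \<open>W r\<close> gives the same relations with \<open>t\<close> and
    \<open>r\<close> interchanged, with new coefficients.\<close>
  from rel[of r] r rn obtain k m n where kmn: "k \<noteq> 0" "m \<noteq> 0" and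
    r': "\<And>b. b \<in> carrier H \<Longrightarrow>
      k * F b x + m * F (b \<otimes> s) y + n = k * F (b \<otimes> r) x + m * F (b \<otimes> r) y + n"
    by metis
  have 2: "F s y + F t y = F r y + F \<one> y" "F r x + F s x = F \<one> x + F t x"
    by (rule direction_relations[OF kmn, of _ _ n];
        use r'[of \<one>] r'[of r] r'[of s] st r in \<open>simp add: tab\<close>)+
  \<comment> \<open>Adding the matching relations of \<open>1\<close> and \<open>2\<close> cancels
    the labels \<open>t\<close> and \<open>r\<close> and leaves twice each claim.\<close>
  have eq: "F \<one> x = F s x" "F \<one> y = F s y" using 1 2 by algebra+
  \<comment> \<open>Otherwise \<open>q\<close> and \<open>y\<close> would span both
    \<open>W \<one>\<close> and \<open>W s\<close>.\<close>
  have "y \<notin> W \<one>"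
    using plane_eq_span[of "W \<one>" q y] plane_eq_span[of "W s" q y] W[of \<one>] W[of s] q y st
      inj_onD[OF inj, of \<one> s] by auto
  then have "vec.span {q, x, y} = UNIV"
    using plane_extend_span[of "W \<one>" q x y] W[of \<one>] q x by auto
  then have "F \<one> z = F s z" for z
    using form.linear_eq_on_span[of "F \<one>" "F s" "{q, x, y}" z] F[of \<one>] F[of s] st eq by fastforce
  then show ?thesis by (rule ext)
qed

section \<open>From lines to normalised forms\<close>

text \<open>A form determines its kernel, so \<open>F \<one> = F s\<close> makes the lines
  \<open>u \<one>\<close> and \<open>u s\<close> equal, against injectivity of
  \<open>u\<close>.\<close>

lemma no_pencil_realizing_elementary_abelian:
  fixes H :: "('h, 'm) monoid_scheme" (structure)
    and u v w :: "'h \<Rightarrow> proj_line"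
  assumes H: "comm_group H" "\<And>a. a \<in> carrier H \<Longrightarrow> a \<otimes> a = \<one>"
    and st: "s \<in> carrier H" "t \<in> carrier H" "s \<noteq> \<one>" "t \<noteq> \<one>" "s \<noteq> t"
    and lines: "u ` carrier H \<subseteq> proj_lines" "v ` carrier H \<subseteq> proj_lines" "w ` carrier H \<subseteq> proj_lines"
    and inj: "inj_on u (carrier H)" "inj_on w (carrier H)"
    and inc: "\<And>a b. \<lbrakk>a \<in> carrier H; b \<in> carrier H\<rbrakk> \<Longrightarrow> \<exists>P. P \<in> u a \<and> P \<in> v b \<and> P \<in> w (a \<otimes> b)"
    and Q: "Q \<in> proj_points" "\<And>c. c \<in> carrier H \<Longrightarrow> Q \<in> w c"
      "\<And>a. a \<in> carrier H \<Longrightarrow> Q \<notin> u a \<and> Q \<notin> v a"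
  shows False
proof -
  interpret comm_group H by fact
  obtain q where q: "q \<noteq> 0" "Q = vec.span {q}" using proj_point_span[OF Q(1)] .
  obtain U where U: "\<And>a. a \<in> carrier H \<Longrightarrow>
      vec.subspace (U a) \<and> vec.dim (U a) = 2 \<and> u a = line_of (U a)"
    by (rule proj_lines_planes[OF lines(1)]) blast
  obtain V where V: "\<And>a. a \<in> carrier H \<Longrightarrow>
      vec.subspace (V a) \<and> vec.dim (V a) = 2 \<and> v a = line_of (V a)"
    by (rule proj_lines_planes[OF lines(2)]) blast
  obtain W where W: "\<And>a. a \<in> carrier H \<Longrightarrow>
      vec.subspace (W a) \<and> vec.dim (W a) = 2 \<and> w a = line_of (W a)"
    by (rule proj_lines_planes[OF lines(3)]) blast
  have qU: "q \<notin> U a" and qV: "q \<notin> V a" and qW: "q \<in> W a" if "a \<in> carrier H" for a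
    using Q(1) Q(2,3)[OF that] U[OF that] V[OF that] W[OF that] q
      span_singleton_subset_iff[of "U a" q] span_singleton_subset_iff[of "V a" q]
      span_singleton_subset_iff[of "W a" q]
    by auto
  have "\<forall>a\<in>carrier H. \<exists>f. linear_form f \<and> f q = 1 \<and> (\<forall>x. f x = 0 \<longleftrightarrow> x \<in> U a)"
    using U qU by (intro ballI plane_has_form) simp_all
  from bchoice[OF this] obtain F where F: "\<And>a. a \<in> carrier H \<Longrightarrow>
      linear_form (F a) \<and> F a q = 1 \<and> (\<forall>x. F a x = 0 \<longleftrightarrow> x \<in> U a)" by auto
  have "\<forall>a\<in>carrier H. \<exists>f. linear_form f \<and> f q = 1 \<and> (\<forall>x. f x = 0 \<longleftrightarrow> x \<in> V a)"
    using V qV by (intro ballI plane_has_form) simp_all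
  from bchoice[OF this] obtain G where G: "\<And>a. a \<in> carrier H \<Longrightarrow>
      linear_form (G a) \<and> G a q = 1 \<and> (\<forall>x. G a x = 0 \<longleftrightarrow> x \<in> V a)" by auto
  \<comment> \<open>On the plane of the line labelled \<open>a \<otimes> b\<close> both forms are 1
    at \<open>q\<close> and 0 at a vector \<open>x\<close> spanning the common point. As
    \<open>x\<close> is not a multiple of \<open>q\<close>, these two vectors span the
    plane.\<close>
  have FG: "F a y = G b y" if ab: "a \<in> carrier H" "b \<in> carrier H" and y: "y \<in> W (a \<otimes> b)" for a b y
  proof -
    have c: "a \<otimes> b \<in> carrier H" using ab by simp
    obtain P where P: "P \<in> u a" "P \<in> v b" "P \<in> w (a \<otimes> b)" using inc ab by blast
    then have "P \<in> proj_points" using U ab by auto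
    then obtain x where x: "x \<noteq> 0" "P = vec.span {x}" by (rule proj_point_span)
    have xm: "x \<in> U a" "x \<in> V b" "x \<in> W (a \<otimes> b)"
      using P U[OF ab(1)] V[OF ab(2)] W[OF c] x
        span_singleton_subset_iff[of "U a" x] span_singleton_subset_iff[of "V b" x]
        span_singleton_subset_iff[of "W (a \<otimes> b)" x]
      by auto
    have "x \<notin> vec.span {q}"
    proof
      assume "x \<in> vec.span {q}"
      then obtain k where "x = k *s q" by (auto simp: vec.span_singleton)
      then have "k \<noteq> 0" and "F a x = k"
        using x F[OF ab(1)] by (auto simp: form.linear_scale)
      then show False using F[OF ab(1)] xm by auto
    qed
    moreover have "F a x = 0" "G b x = 0" using F[OF ab(1)] G[OF ab(2)] xm by blast+
    then have "F a x = G b x" by simp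
    moreover have "linear_form (F a)" "linear_form (G b)" "F a q = G b q"
      using F[OF ab(1)] G[OF ab(2)] by simp_all
    ultimately show ?thesis
      using forms_eq_on_plane W[OF c] qW[OF c] xm(3) q(1) y by blast
  qed
  have "inj_on W (carrier H)" using inj(2) W by (auto simp: inj_on_def)
  then have "F \<one> = F s"
    using W qW q(1) F G FG
    by (intro elementary_abelian_forms_coincide[OF H st, of W q F G]) simp_all
  then have "U \<one> = U s" using F[of \<one>] F[of s] st by auto
  then have "u \<one> = u s" using U[of \<one>] U[of s] st by auto
  then show False using inj st by (auto dest: inj_onD)
qed

section \<open>Application to the net\<close>

text \<open>If the centre lay on \<open>l\<close>, it would be the meeting point of
  \<open>l1\<close> and \<open>l\<close>, hence in \<open>X\<close>; but then both \<open>l1\<close>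
  and \<open>l2\<close> would be lines of \<open>C i\<close> through a point of
  \<open>X\<close>.\<close>

lemma three_net_pencil_centre:
  assumes net: "three_net A C X" and ij: "i \<in> {1..3}" "j \<in> {1..3}" "i \<noteq> j"
    and centre: "\<And>l. l \<in> C i \<Longrightarrow> Q \<in> l"
    and two: "l1 \<in> C i" "l2 \<in> C i" "l1 \<noteq> l2" and l: "l \<in> C j"
  shows "Q \<notin> l"
proof
  assume "Q \<in> l"
  have meet: "\<forall>i\<in>{1..3}. \<forall>j\<in>{1..3}. i \<noteq> j \<longrightarrow> (\<forall>l\<in>C i. \<forall>l'\<in>C j. \<exists>P\<in>X. l \<inter> l' = {P})"
    using net unfolding three_net_def by (elim conjE)
  have through: "\<forall>P\<in>X. \<forall>i\<in>{1..3}. \<exists>!l. l \<in> C i \<and> P \<in> l"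
    using net unfolding three_net_def by (elim conjE)
  from bspec[OF bspec[OF meet ij(1)] ij(2)] ij(3) have "\<exists>P\<in>X. l1 \<inter> l = {P}"
    using two(1) l by simp
  then obtain P where P: "P \<in> X" "l1 \<inter> l = {P}" by (elim bexE)
  have "Q \<in> l1 \<inter> l" using \<open>Q \<in> l\<close> centre[OF two(1)] by (rule IntI[rotated])
  then have "Q \<in> X" using P by (simp only: singleton_iff)
  from bspec[OF bspec[OF through this] ij(1)] show False
    using centre[OF two(1)] centre[OF two(2)] two by (metis (no_types))
qed

theorem theorem4p3:
  "\<not> (\<exists>(A :: proj_line set) (C :: nat \<Rightarrow> proj_line set) (X :: proj_point set).
        three_net A C X \<and>
        realizes_group C (integer_mod_group 2 \<times>\<times> integer_mod_group 2) \<and>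
        (\<exists>i\<in>{1..3}. is_pencil (C i)))"
proof clarify
  fix A :: "proj_line set" and C X i
  assume net: "three_net A C X"
    and real: "realizes_group C (integer_mod_group 2 \<times>\<times> integer_mod_group 2)"
    and i: "i \<in> {1..3::nat}" and pencil: "is_pencil (C i)"
  define H where "H = integer_mod_group 2 \<times>\<times> integer_mod_group 2"
  have H: "comm_group H"
    unfolding H_def
    by (rule group.group_comm_groupI) (auto simp: DirProd_group add.commute)
  interpret comm_group H by (rule H)
  have carrier: "carrier H = {0..<2} \<times> {0..<2}"
    by (simp add: H_def carrier_integer_mod_group)
  have one: "\<one>\<^bsub>H\<^esub> = (0, 0)" by (simp add: H_def)
  \<comment> \<open>This holds even outside the carrier, because the operation reduces modulo
    2.\<close>
  have sq: "a \<otimes>\<^bsub>H\<^esub> a = \<one>\<^bsub>H\<^esub>" for a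
    by (cases a) (simp add: one, simp add: H_def)
  have st: "(0, 1) \<in> carrier H" "(1, 0) \<in> carrier H" "(0, 1) \<noteq> \<one>\<^bsub>H\<^esub>" "(1, 0) \<noteq> \<one>\<^bsub>H\<^esub>"
    "(0 :: int, 1 :: int) \<noteq> (1, 0)"
    by (auto simp: one carrier)
  have cancel: "a \<otimes>\<^bsub>H\<^esub> (a \<otimes>\<^bsub>H\<^esub> b) = b" if "a \<in> carrier H" "b \<in> carrier H" for a b
    using that sq by (simp flip: m_assoc)
  have "\<exists>\<phi>. (\<forall>i\<in>{1..3}. bij_betw (\<phi> i) (carrier H) (C i)) \<and>
      (\<forall>a\<in>carrier H. \<forall>b\<in>carrier H. \<exists>P. \<phi> 1 a \<inter> \<phi> 2 b = {P} \<and> P \<in> \<phi> 3 (a \<otimes>\<^bsub>H\<^esub> b))"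
    using real by (simp only: realizes_group_def H_def)
  then obtain \<phi> where bij: "\<forall>i\<in>{1..3}. bij_betw (\<phi> i) (carrier H) (C i)"
    and meet: "\<forall>a\<in>carrier H. \<forall>b\<in>carrier H.
        \<exists>P. \<phi> 1 a \<inter> \<phi> 2 b = {P} \<and> P \<in> \<phi> 3 (a \<otimes>\<^bsub>H\<^esub> b)"
    by (elim exE conjE)
  have inc: "\<exists>P. P \<in> \<phi> 1 a \<and> P \<in> \<phi> 2 b \<and> P \<in> \<phi> 3 (a \<otimes>\<^bsub>H\<^esub> b)"
    if "a \<in> carrier H" "b \<in> carrier H" for a b
    using meet that by blast
  obtain Q where Q: "Q \<in> proj_points" "\<And>l. l \<in> C i \<Longrightarrow> Q \<in> l"
    using pencil by (auto simp: is_pencil_def)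
  have mem: "\<phi> j a \<in> C j" if "j \<in> {1..3}" "a \<in> carrier H" for j a
    using bspec[OF bij that(1)] that by (auto simp: bij_betw_def)
  have lines: "\<phi> j ` carrier H \<subseteq> proj_lines" if "j \<in> {1..3}" for j
  proof -
    have "A \<subseteq> proj_lines" using net unfolding three_net_def by (elim conjE)
    moreover have "A = (\<Union>i\<in>{1..3}. C i)" using net unfolding three_net_def by (elim conjE)
    ultimately show ?thesis using mem that by blast
  qed
  have inj: "inj_on (\<phi> j) (carrier H)" if "j \<in> {1..3}" for j
    using bspec[OF bij that] by (auto simp: bij_betw_def)
  \<comment> \<open>Two distinct lines of the pencil, as needed to keep its centre off the other
    classes.\<close>
  have "\<phi> i \<one>\<^bsub>H\<^esub> \<noteq> \<phi> i (0, 1)" using inj[OF i] st by (auto dest: inj_onD)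
  then have off: "Q \<notin> \<phi> j a" if "j \<in> {1..3}" "j \<noteq> i" "a \<in> carrier H" for j a
    using three_net_pencil_centre[OF net i, of j Q "\<phi> i \<one>\<^bsub>H\<^esub>" "\<phi> i (0, 1)"] Q mem that i st by auto
  text \<open>In a group of exponent two, \<open>a + b = c\<close> is symmetric in \<open>a, b, c\<close>, so any class can play
    the role of the third.\<close>
  have False if jk: "j \<in> {1..3}" "k \<in> {1..3}" "j \<noteq> i" "k \<noteq> i"
    and "\<And>a b. \<lbrakk>a \<in> carrier H; b \<in> carrier H\<rbrakk> \<Longrightarrow>
        \<exists>P. P \<in> \<phi> j a \<and> P \<in> \<phi> k b \<and> P \<in> \<phi> i (a \<otimes>\<^bsub>H\<^esub> b)" for j k
    by (rule no_pencil_realizing_elementary_abelian[OF H sq st, of "\<phi> j" "\<phi> k" "\<phi> i" Q])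
      (use that lines inj i Q mem off in auto)
  note * = this
  consider "i = 1" | "i = 2" | "i = 3" using i by force
  then show False
  proof cases
    case 1
    have "\<exists>P. P \<in> \<phi> 2 a \<and> P \<in> \<phi> 3 b \<and> P \<in> \<phi> 1 (a \<otimes>\<^bsub>H\<^esub> b)"
      if "a \<in> carrier H" "b \<in> carrier H" for a b
      using inc[of "a \<otimes>\<^bsub>H\<^esub> b" a] cancel[of a b] m_comm[of "a \<otimes>\<^bsub>H\<^esub> b" a] that by auto
    then show False using *[of 2 3] 1 by auto
  next
    case 2
    have "\<exists>P. P \<in> \<phi> 1 a \<and> P \<in> \<phi> 3 b \<and> P \<in> \<phi> 2 (a \<otimes>\<^bsub>H\<^esub> b)"
      if "a \<in> carrier H" "b \<in> carrier H" for a b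
      using inc[of a "a \<otimes>\<^bsub>H\<^esub> b"] cancel[of a b] that by auto
    then show False using *[of 1 3] 2 by auto
  next
    case 3
    then show False using *[of 1 2] inc by auto
  qed
qed

end
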